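(* Let $\Omega$ be an arbitrary non-empty set, $\mathcal{E}\subseteq\mathcal{P}(\Omega)$ an arbitrary non-empty family of events, and let $s:\{0,1\}\times[0,1]\to[0,+\infty]$ be a fixed proper scoring rule. The following statements hold: (i) a belief assessment $Bel:\mathcal{E}\to[0,1]$ is coherent-3 (and so coherent) if and only if it is coherent-5($s$); (ii) a probability assessment $P:\mathcal{E}\to[0,1]$ is coherent-3P (and so coherent-P) if and only if it is coherent-5P($s$); (iii) a necessity assessment $N:\mathcal{E}\to[0,1]$ is coherent-3N (and so coherent-N) if and only if it is coherent-5N($s$).
   Context: A belief (respectively probability, necessity) assessment on $\mathcal{E}$ is an arbitrary function $\mathcal{E}\to[0,1]$. $\mathcal{P}(\Omega)$ is the power set of $\Omega$; $\mathbf{1}_A:\Omega\to\{0,1\}$ is the indicator of $A$. Proper scoring rule: a function $s:\{0,1\}\times[0,1]\to[0,+\infty]$ is a (strictly) proper scoring rule if (a) for every $p\in[0,1]$, the function $x\mapsto p\,s(1,x)+(1-p)\,s(0,x)$ on $[0,1]$ is uniquely minimized at $x=p$ (with the convention $0\cdot(+\infty)=0$); and (b) for every $i\in\{0,1\}$, $s(i,x)$ is continuous in $x\in[0,1]$ (as a $[0,+\infty]$-valued function). For a finite non-empty family $\mathcal{F}=\{E_1,\dots,E_n\}\subseteq\mathcal{E}$, $\mathcal{A}_{\mathcal{F}}$ is the minimal algebra of subsets of $\Omega$ containing $\mathcal{F}$, $\mathcal{U}_{\mathcal{F}}=\mathcal{A}_{\mathcal{F}}\setminus\{\emptyset\}$,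 and $\mathcal{C}_{\mathcal{F}}=\{C_1,\dots,C_m\}$ is the set of atoms of $\mathcal{A}_{\mathcal{F}}$ (the finest partition of $\Omega$ contained in $\mathcal{A}_{\mathcal{F}}$). $\mathbf{chains}(\mathcal{U}_{\mathcal{F}})$ is the collection of subfamilies $\mathcal{D}_{\mathcal{F}}=\{D_1,\dots,D_m\}$ of $\mathcal{U}_{\mathcal{F}}$ of the form $D_1=C_{i_1}$, $D_2=C_{i_1}\cup C_{i_2}$, $\dots$, $D_m=C_{i_1}\cup\cdots\cup C_{i_m}=\Omega$, for a permutation $(i_1,\dots,i_m)$ of $(1,\dots,m)$. For $B\neq\emptyset$, $\min_{\omega\in B}\mathbf{1}_E(\omega)$ equals $1$ if $B\subseteq E$ and $0$ otherwise. Auxiliary notation: for an assessment $\varphi:\mathcal{E}\to[0,1]$, a finite $\mathcal{F}=\{E_1,\dots,E_n\}\subseteq\mathcal{E}$ and a non-empty $\mathcal{V}\subseteq\mathcal{U}_{\mathcal{F}}$, consider (S) [linear system over $\mathcal{V}$]: $\sum_{B\in\mathcal{V}}\big(\min_{\omega\in B}\mathbf{1}_{E_i}(\omega)\big)x_B=\varphi(E_i)$ for $i=1,\dots,n$; $\sum_{B\in\mathcal{V}}x_B=1$; $x_B\ge 0$ for every $B\in\mathcal{V}$, with unknowns $x_B$, $B\in\mathcal{V}$; (D) [non-dominance over $\mathcal{V}$]: there is no assessment $\varphi^*:\mathcal{F}\to[0,1]$ distinct from the restriction of $\varphi$ to $\mathcal{F}$ such that $L^*_{\mathcal{F}}(B)<L_{\mathcal{F}}(B)$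 for every $B\in\mathcal{V}$, where $L^*_{\mathcal{F}}(B)=\sum_{i=1}^n s\big(\min_{\omega\in B}\mathbf{1}_{E_i}(\omega),\varphi^*(E_i)\big)$ and $L_{\mathcal{F}}(B)=\sum_{i=1}^n s\big(\min_{\omega\in B}\mathbf{1}_{E_i}(\omega),\varphi(E_i)\big)$, with values in $[0,+\infty]$. Definitions (in each, the condition is required for every $n\in\mathbb{N}$ and every $\mathcal{F}=\{E_1,\dots,E_n\}\subseteq\mathcal{E}$): - $Bel$ is coherent-3 if system (S) with $\varphi=Bel$, $\mathcal{V}=\mathcal{U}_{\mathcal{F}}$ has a solution; $Bel$ is coherent-5($s$) if (D) holds with $\varphi=Bel$, $\mathcal{V}=\mathcal{U}_{\mathcal{F}}$. - $P$ is coherent-3P if system (S) with $\varphi=P$, $\mathcal{V}=\mathcal{C}_{\mathcal{F}}$ has a solution; $P$ is coherent-5P($s$) if (D) holds with $\varphi=P$, $\mathcal{V}=\mathcal{C}_{\mathcal{F}}$. - $N$ is coherent-3N if there exists $\mathcal{D}_{\mathcal{F}}\in\mathbf{chains}(\mathcal{U}_{\mathcal{F}})$ such that system (S) with $\varphi=N$, $\mathcal{V}=\mathcal{D}_{\mathcal{F}}$ has a solution; $N$ is coherent-5N($s$) if there exists $\mathcal{D}_{\mathcal{F}}\in\mathbf{chains}(\mathcal{U}_{\mathcal{F}})$ such that (D) holds with $\varphi=N$, $\mathcal{V}=\mathcal{D}_{\mathcal{F}}$. Terminology: an assessment that is coherent-3 (respectively coherent-3P, coherent-3N) is called coherent (respectively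 coherent-P, coherent-N). *)

theory Defs
  imports "HOL-Analysis.Analysis"
begin

text \<open>An assessment on \<open>\<E>\<close> is represented by a total function of which only the values on
  \<open>\<E>\<close> are relevant.\<close>

definition assessment :: "'a set set \<Rightarrow> ('a set \<Rightarrow> real) \<Rightarrow> bool" where
  "assessment \<E> \<phi> \<longleftrightarrow> \<phi> \<in> \<E> \<rightarrow> {0..1}"

text \<open>A scoring rule is a total function of which only the values on \<open>{0,1} \<times> [0,1]\<close> are
  relevant. The product on \<^typ>\<open>ennreal\<close> satisfies \<open>0 * \<infinity> = 0\<close>, and continuity refers to the
  order topology of the extended half-line.\<close>

definition expected_score :: "(real \<Rightarrow> real \<Rightarrow> ennreal) \<Rightarrow> real \<Rightarrow> real \<Rightarrow> ennreal" where
  "expected_score s p x = ennreal p * s 1 x + ennreal (1 - p) * s 0 x"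

definition proper_scoring_rule :: "(real \<Rightarrow> real \<Rightarrow> ennreal) \<Rightarrow> bool" where
  "proper_scoring_rule s \<longleftrightarrow>
     (\<forall>p\<in>{0..1}. \<forall>x\<in>{0..1}. x \<noteq> p \<longrightarrow> expected_score s p p < expected_score s p x) \<and>
     (\<forall>i\<in>{0, 1}. continuous_on {0..1} (s i))"

definition gen_algebra :: "'a set \<Rightarrow> 'a set set \<Rightarrow> 'a set set" where
  "gen_algebra \<Omega> \<F> = \<Inter>{\<A>. algebra \<Omega> \<A> \<and> \<F> \<subseteq> \<A>}"

definition nonempty_events :: "'a set \<Rightarrow> 'a set set \<Rightarrow> 'a set set" where
  "nonempty_events \<Omega> \<F> = gen_algebra \<Omega> \<F> - {{}}"

definition atoms :: "'a set \<Rightarrow> 'a set set \<Rightarrow> 'a set set" where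
  "atoms \<Omega> \<F> = {C \<in> nonempty_events \<Omega> \<F>. \<forall>B \<in> nonempty_events \<Omega> \<F>. B \<subseteq> C \<longrightarrow> B = C}"

text \<open>The list \<open>cs\<close> enumerates the atoms in the order given by a permutation.\<close>

definition chains :: "'a set \<Rightarrow> 'a set set \<Rightarrow> 'a set set set" where
  "chains \<Omega> \<F> = {{\<Union>(set (take k cs)) | k. k \<in> {1..length cs}} | cs.
     distinct cs \<and> set cs = atoms \<Omega> \<F>}"

text \<open>For infinite \<open>B\<close> the minimum is still meaningful, because the set of values of the
  indicator function is finite.\<close>

definition min_ind :: "'a set \<Rightarrow> 'a set \<Rightarrow> real" where
  "min_ind B E = Min (indicator E ` B)"

text \<open>In the following definitions \<open>\<F>\<close> is finite, hence so is every \<open>\<V>\<close> contained in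
  the algebra generated by \<open>\<F>\<close>.\<close>

definition system_solvable :: "'a set set \<Rightarrow> 'a set set \<Rightarrow> ('a set \<Rightarrow> real) \<Rightarrow> bool" where
  "system_solvable \<F> \<V> \<phi> \<longleftrightarrow> (\<exists>x :: 'a set \<Rightarrow> real.
     (\<forall>E\<in>\<F>. (\<Sum>B\<in>\<V>. min_ind B E * x B) = \<phi> E) \<and>
     (\<Sum>B\<in>\<V>. x B) = 1 \<and>
     (\<forall>B\<in>\<V>. x B \<ge> 0))"

definition loss ::
  "(real \<Rightarrow> real \<Rightarrow> ennreal) \<Rightarrow> 'a set set \<Rightarrow> ('a set \<Rightarrow> real) \<Rightarrow> 'a set \<Rightarrow> ennreal" where
  "loss s \<F> \<phi> B = (\<Sum>E\<in>\<F>. s (min_ind B E) (\<phi> E))"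

definition non_dominated ::
  "(real \<Rightarrow> real \<Rightarrow> ennreal) \<Rightarrow> 'a set set \<Rightarrow> 'a set set \<Rightarrow> ('a set \<Rightarrow> real) \<Rightarrow> bool" where
  "non_dominated s \<F> \<V> \<phi> \<longleftrightarrow>
     \<not> (\<exists>\<phi>'. assessment \<F> \<phi>' \<and> (\<exists>E\<in>\<F>. \<phi>' E \<noteq> \<phi> E) \<and>
            (\<forall>B\<in>\<V>. loss s \<F> \<phi>' B < loss s \<F> \<phi> B))"

definition coherent_3 :: "'a set \<Rightarrow> 'a set set \<Rightarrow> ('a set \<Rightarrow> real) \<Rightarrow> bool" where
  "coherent_3 \<Omega> \<E> Bel \<longleftrightarrow>
     (\<forall>\<F>. finite \<F> \<and> \<F> \<noteq> {} \<and> \<F> \<subseteq> \<E> \<longrightarrow> system_solvable \<F> (nonempty_events \<Omega> \<F>) Bel)"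

definition coherent_5 ::
  "(real \<Rightarrow> real \<Rightarrow> ennreal) \<Rightarrow> 'a set \<Rightarrow> 'a set set \<Rightarrow> ('a set \<Rightarrow> real) \<Rightarrow> bool" where
  "coherent_5 s \<Omega> \<E> Bel \<longleftrightarrow>
     (\<forall>\<F>. finite \<F> \<and> \<F> \<noteq> {} \<and> \<F> \<subseteq> \<E> \<longrightarrow> non_dominated s \<F> (nonempty_events \<Omega> \<F>) Bel)"

definition coherent_3P :: "'a set \<Rightarrow> 'a set set \<Rightarrow> ('a set \<Rightarrow> real) \<Rightarrow> bool" where
  "coherent_3P \<Omega> \<E> P \<longleftrightarrow>
     (\<forall>\<F>. finite \<F> \<and> \<F> \<noteq> {} \<and> \<F> \<subseteq> \<E> \<longrightarrow> system_solvable \<F> (atoms \<Omega> \<F>) P)"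

definition coherent_5P ::
  "(real \<Rightarrow> real \<Rightarrow> ennreal) \<Rightarrow> 'a set \<Rightarrow> 'a set set \<Rightarrow> ('a set \<Rightarrow> real) \<Rightarrow> bool" where
  "coherent_5P s \<Omega> \<E> P \<longleftrightarrow>
     (\<forall>\<F>. finite \<F> \<and> \<F> \<noteq> {} \<and> \<F> \<subseteq> \<E> \<longrightarrow> non_dominated s \<F> (atoms \<Omega> \<F>) P)"

definition coherent_3N :: "'a set \<Rightarrow> 'a set set \<Rightarrow> ('a set \<Rightarrow> real) \<Rightarrow> bool" where
  "coherent_3N \<Omega> \<E> N \<longleftrightarrow>
     (\<forall>\<F>. finite \<F> \<and> \<F> \<noteq> {} \<and> \<F> \<subseteq> \<E> \<longrightarrow> (\<exists>\<D>\<in>chains \<Omega> \<F>. system_solvable \<F> \<D> N))"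

definition coherent_5N ::
  "(real \<Rightarrow> real \<Rightarrow> ennreal) \<Rightarrow> 'a set \<Rightarrow> 'a set set \<Rightarrow> ('a set \<Rightarrow> real) \<Rightarrow> bool" where
  "coherent_5N s \<Omega> \<E> N \<longleftrightarrow>
     (\<forall>\<F>. finite \<F> \<and> \<F> \<noteq> {} \<and> \<F> \<subseteq> \<E> \<longrightarrow> (\<exists>\<D>\<in>chains \<Omega> \<F>. non_dominated s \<F> \<D> N))"

end

theory Submission
  imports Defs
begin

text \<open>A solution of the linear system expresses the assessment as a mixture of the outcome
  vectors \<open>(min_ind B E)\<close>, \<open>E \<in> \<F>\<close>, and averaging the losses with the same weights gives expected
  scores, which propriety makes strictly minimal; hence nothing dominates. Conversely, if \<open>\<phi>\<close> is
  not such a mixture, restrict to the \<open>B\<close> at which its loss is finite and take the Bregman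
  projection of \<open>\<phi>\<close> onto the hull of the corresponding vectors, i.e. minimise over mixtures the
  expected excess loss of \<open>\<phi>\<close>. By first-order optimality the minimiser has smaller loss at each of
  these \<open>B\<close>. Moving it slightly towards the constant \<open>1/2\<close> keeps these strict inequalities and
  makes all losses finite, so that it also wins where the loss of \<open>\<phi>\<close> is infinite.\<close>

section \<open>A limit at the boundary of the unit interval\<close>

text \<open>With \<open>q\<close> fixed, \<open>le\<close> bounds \<open>p * a p\<close> by a term
  tending to \<open>b q - b 0\<close>, which is small for \<open>q\<close> near 0. Intended for a
  score \<open>a\<close> that may blow up at 0.\<close>

lemma tendsto_id_mult_zero_at_right:
  fixes a b :: "real \<Rightarrow> real"
  assumes a: "\<And>x. 0 \<le> a x"
    and b: "(b \<longlongrightarrow> b 0) (at_right 0)"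
    and le: "\<And>p q. 0 < p \<Longrightarrow> p < 1 \<Longrightarrow> 0 < q \<Longrightarrow> q < 1 \<Longrightarrow>
      p * a p + (1 - p) * b p \<le> p * a q + (1 - p) * b q"
  shows "((\<lambda>p. p * a p) \<longlongrightarrow> 0) (at_right 0)"
proof (rule order_tendstoI)
  fix l :: real assume "l < 0"
  have "eventually (\<lambda>p. (0::real) < p) (at_right 0)"
    by (simp add: eventually_at_right_less)
  then show "eventually (\<lambda>p. l < p * a p) (at_right 0)"
  proof eventually_elim
    case (elim p)
    then have "0 \<le> p * a p" using a by simp
    then show ?case using \<open>l < 0\<close> by linarith
  qed
next
  fix u :: real assume u: "0 < u"
  have small: "eventually (\<lambda>p. 0 < p \<and> p < 1) (at_right (0::real))"
    using eventually_at_right_real[of 0 1] by (auto elim: eventually_mono)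
  have "eventually (\<lambda>q. b q < b 0 + u) (at_right 0)"
    using b u by (intro order_tendstoD(2)[OF b]) simp
  with small have "eventually (\<lambda>q. 0 < q \<and> q < 1 \<and> b q < b 0 + u) (at_right 0)"
    by eventually_elim simp
  then obtain q where q: "0 < q" "q < 1" "b q < b 0 + u"
    using eventually_happens trivial_limit_at_right_real by blast
  have "((\<lambda>p. p * a q + (1 - p) * b q - (1 - p) * b p) \<longlongrightarrow>
         0 * a q + (1 - 0) * b q - (1 - 0) * b 0) (at_right 0)"
    by (intro tendsto_intros b)
  then have "eventually (\<lambda>p. p * a q + (1 - p) * b q - (1 - p) * b p < u) (at_right 0)"
    by (rule order_tendstoD(2)) (use q in simp)
  with small show "eventually (\<lambda>p. p * a p < u) (at_right 0)"
  proof eventually_elim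
    case (elim p)
    then show ?case using le[of p q] q by linarith
  qed
qed

section \<open>Outcome vectors and their mixtures\<close>

lemma min_ind_cases:
  assumes "B \<noteq> {}" shows "min_ind B E = 0 \<or> min_ind B E = 1"
proof -
  have sub: "(indicator E ` B :: real set) \<subseteq> {0, 1}" by (auto simp: indicator_def)
  then have "Min (indicator E ` B :: real set) \<in> indicator E ` B"
    using assms by (intro Min_in) (auto intro: finite_subset)
  with sub show ?thesis by (auto simp: min_ind_def)
qed

lemma min_ind_bounds:
  assumes "B \<noteq> {}" shows "0 \<le> min_ind B E" "min_ind B E \<le> 1"
  using min_ind_cases[OF assms, of E] by auto

definition prob_weights :: "'b set \<Rightarrow> ('b \<Rightarrow> real) \<Rightarrow> bool" where
  "prob_weights V x \<longleftrightarrow> (\<forall>B\<in>V. 0 \<le> x B) \<and> (\<Sum>B\<in>V. x B) = 1"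

text \<open>For non-empty \<open>B\<close>, \<open>min_ind B E\<close> is 1 exactly when
  \<open>B \<subseteq> E\<close>, so this is the belief function with mass function \<open>x\<close>
  and focal sets in \<open>V\<close>.\<close>

definition mixture :: "'a set set \<Rightarrow> ('a set \<Rightarrow> real) \<Rightarrow> 'a set \<Rightarrow> real" where
  "mixture V x E = (\<Sum>B\<in>V. min_ind B E * x B)"

lemma system_solvable_iff_mixture:
  "system_solvable F V \<phi> \<longleftrightarrow> (\<exists>x. prob_weights V x \<and> (\<forall>E\<in>F. mixture V x E = \<phi> E))"
  unfolding system_solvable_def prob_weights_def mixture_def by blast

lemma mixture_bounds:
  assumes "{} \<notin> V" "prob_weights V x"
  shows "mixture V x E \<in> {0..1}"
proof -
  have 0: "0 \<le> mixture V x E"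
    unfolding mixture_def using assms
    by (intro sum_nonneg mult_nonneg_nonneg min_ind_bounds(1)) (auto simp: prob_weights_def)
  have "mixture V x E \<le> (\<Sum>B\<in>V. 1 * x B)"
    unfolding mixture_def using assms
    by (intro sum_mono mult_right_mono min_ind_bounds(2)) (auto simp: prob_weights_def)
  with 0 assms(2) show ?thesis by (simp add: prob_weights_def)
qed

text \<open>Weights are total functions; confining the coordinates outside \<open>V\<close> as well
  gives a closed subset of a product of compact intervals, so Tychonoff applies.\<close>

lemma compact_prob_weights:
  fixes V :: "'b set"
  assumes "finite V"
  shows "compact {x :: 'b \<Rightarrow> real. (\<forall>B. x B \<in> {0..1}) \<and> (\<Sum>B\<in>V. x B) = 1}"
proof -
  have "compactin (product_topology (\<lambda>_. euclidean) UNIV) (PiE (UNIV::'b set) (\<lambda>_. {0..1::real}))"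
    by (subst compactin_PiE) auto
  then have c: "compact (PiE (UNIV::'b set) (\<lambda>_. {0..1::real}))"
    by (simp add: euclidean_product_topology)
  have cl: "closed {x :: 'b \<Rightarrow> real. (\<Sum>B\<in>V. x B) = 1}"
    by (intro closed_Collect_eq continuous_on_sum continuous_on_product_coordinates
          continuous_on_const)
  have "{x :: 'b \<Rightarrow> real. (\<forall>B. x B \<in> {0..1}) \<and> (\<Sum>B\<in>V. x B) = 1} =
    PiE UNIV (\<lambda>_. {0..1}) \<inter> {x. (\<Sum>B\<in>V. x B) = 1}"
    by (auto simp: PiE_def Pi_def)
  then show ?thesis using compact_Int_closed[OF c cl] by simp
qed

text \<open>At a deterministic outcome the expected score is the score itself, so averaging the
  losses over the weights gives the expected score of the mixture.\<close>

lemma sum_loss_eq_expected_score: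
  assumes V: "{} \<notin> V" and x: "prob_weights V x"
  shows "(\<Sum>B\<in>V. ennreal (x B) * loss s F y B) =
         (\<Sum>E\<in>F. expected_score s (mixture V x E) (y E))"
proof -
  have x0: "0 \<le> x B" if "B \<in> V" for B using x that by (simp add: prob_weights_def)
  have m0: "0 \<le> min_ind B E" "0 \<le> 1 - min_ind B E" if "B \<in> V" for B E
    using min_ind_bounds[of B E] V that by auto
  \<comment> \<open>At least one weight on the right is 0, and \<open>0 * \<infinity> = 0\<close>
    removes its term even if the score is infinite.\<close>
  have score_split: "ennreal (x B) * s (min_ind B E) (y E) =
      ennreal (min_ind B E * x B) * s 1 (y E) + ennreal ((1 - min_ind B E) * x B) * s 0 (y E)"
    if "B \<in> V" for B E
  proof -
    have "min_ind B E = 0 \<or> min_ind B E = 1" using V that by (intro min_ind_cases) auto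
    then show ?thesis by auto
  qed
  have one: "(\<Sum>B\<in>V. (1 - min_ind B E) * x B) = 1 - mixture V x E" for E
    using x by (simp add: mixture_def prob_weights_def left_diff_distrib sum_subtractf)
  have "(\<Sum>B\<in>V. ennreal (x B) * loss s F y B) =
      (\<Sum>B\<in>V. \<Sum>E\<in>F. ennreal (x B) * s (min_ind B E) (y E))"
    by (simp add: loss_def sum_distrib_left)
  also have "\<dots> = (\<Sum>E\<in>F. \<Sum>B\<in>V. ennreal (x B) * s (min_ind B E) (y E))"
    by (rule sum.swap)
  also have "\<dots> = (\<Sum>E\<in>F. (\<Sum>B\<in>V. ennreal (min_ind B E * x B)) * s 1 (y E) +
      (\<Sum>B\<in>V. ennreal ((1 - min_ind B E) * x B)) * s 0 (y E))"
    by (simp add: score_split sum.distrib sum_distrib_right)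
  also have "\<dots> = (\<Sum>E\<in>F. expected_score s (mixture V x E) (y E))"
    using x0 m0 by (simp add: expected_score_def sum_ennreal one flip: mixture_def)
  finally show ?thesis .
qed

lemma segment_in_unit_interval:
  fixes a b t :: real
  assumes "a \<in> {0..1}" "b \<in> {0..1}" "0 \<le> t" "t \<le> 1"
  shows "(1 - t) * a + t * b \<in> {0..1}"
  using assms convex_bound_le[of a 1 b "1 - t" t] by auto

section \<open>Finiteness and continuity for proper scoring rules\<close>

context
  fixes s :: "real \<Rightarrow> real \<Rightarrow> ennreal"
  assumes proper: "proper_scoring_rule s"
begin

lemma expected_score_less:
  "\<lbrakk>p \<in> {0..1}; x \<in> {0..1}; x \<noteq> p\<rbrakk> \<Longrightarrow> expected_score s p p < expected_score s p x"
  using proper by (simp add: proper_scoring_rule_def)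

lemma expected_score_le:
  "\<lbrakk>p \<in> {0..1}; x \<in> {0..1}\<rbrakk> \<Longrightarrow> expected_score s p p \<le> expected_score s p x"
  using expected_score_less[of p x] by (cases "x = p") auto

text \<open>Strict minimality against any second report puts the value below some extended
  real.\<close>

lemma expected_score_self_finite:
  assumes "p \<in> {0..1}" shows "expected_score s p p < top"
proof -
  obtain x :: real where "x \<in> {0..1}" "x \<noteq> p"
    by (cases "p = 0") (use that[of 0] that[of 1] in auto)
  then show ?thesis
    using expected_score_less[OF assms] top.not_eq_extremum by fastforce
qed

text \<open>In a finite expected score, every outcome of positive probability has a finite score.
  Hence only \<open>s 1 0\<close> and \<open>s 0 1\<close> can be infinite.\<close>

lemma score_finite:
  assumes "x \<in> {0..1}" shows "0 < x \<Longrightarrow> s 1 x < top" and "x < 1 \<Longrightarrow> s 0 x < top"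
  using expected_score_self_finite[OF assms]
  by (auto simp: expected_score_def ennreal_mult_less_top)

lemma score_interior_finite:
  assumes "0 < x" "x < 1" "i = 0 \<or> i = 1" shows "s i x < top"
  using score_finite[of x] assms by auto

lemma continuous_on_score:
  "i = 0 \<or> i = 1 \<Longrightarrow> continuous_on {0..1} (s i)"
  using proper by (auto simp: proper_scoring_rule_def)

lemma enn2real_score_tendsto:
  assumes "i = 0 \<or> i = 1" "p \<in> {0..1}" "s i p < top"
  shows "((\<lambda>x. enn2real (s i x)) \<longlongrightarrow> enn2real (s i p)) (at p within {0..1})"
  using continuous_on_score[OF assms(1)] assms(2,3)
  by (intro tendsto_enn2real) (auto simp: continuous_on_def)

lemma enn2real_expected_score:
  assumes "p \<in> {0..1}" "0 < q" "q < 1"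
  shows "enn2real (expected_score s p q) = p * enn2real (s 1 q) + (1 - p) * enn2real (s 0 q)"
  using assms score_interior_finite[of q 0] score_interior_finite[of q 1]
  by (simp add: expected_score_def enn2real_plus enn2real_mult ennreal_mult_less_top)

lemma enn2real_expected_score_self:
  assumes "p \<in> {0..1}"
  shows "enn2real (expected_score s p p) = p * enn2real (s 1 p) + (1 - p) * enn2real (s 0 p)"
proof -
  consider "p = 0" | "p = 1" | "0 < p" "p < 1" using assms by fastforce
  then show ?thesis
    by cases (use assms enn2real_expected_score[of p p] in \<open>auto simp: expected_score_def\<close>)
qed

text \<open>This is the generalized entropy of the rule. Only the endpoints are delicate: one score
  may blow up there, but its product with the vanishing probability tends to 0.\<close>

lemma continuous_on_expected_score_self:
  "continuous_on {0..1} (\<lambda>p. enn2real (expected_score s p p))"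
proof -
  \<comment> \<open>\<open>enn2real\<close> sends an infinite score to 0, so \<open>a\<close> may be
    discontinuous at 0 and \<open>b\<close> at 1; hence the half-open ranges in \<open>lim_a\<close>
    and \<open>lim_b\<close>.\<close>
  define a b where "a = (\<lambda>x. enn2real (s 1 x))" and "b = (\<lambda>x. enn2real (s 0 x))"
  have lim_a: "(a \<longlongrightarrow> a p) (at p within {0..1})" if "0 < p" "p \<le> 1" for p
    unfolding a_def using that score_finite(1)[of p] by (intro enn2real_score_tendsto) auto
  have lim_b: "(b \<longlongrightarrow> b p) (at p within {0..1})" if "0 \<le> p" "p < 1" for p
    unfolding b_def using that score_finite(2)[of p] by (intro enn2real_score_tendsto) auto
  have le: "p * a p + (1 - p) * b p \<le> p * a q + (1 - p) * b q"
    if "0 < p" "p < 1" "0 < q" "q < 1" for p q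
  proof -
    have "expected_score s p q < top"
      using score_interior_finite[of q 0] score_interior_finite[of q 1] that
      by (simp add: expected_score_def ennreal_mult_less_top)
    then have "enn2real (expected_score s p p) \<le> enn2real (expected_score s p q)"
      using that by (intro enn2real_mono expected_score_le) auto
    then show ?thesis
      using that by (simp add: enn2real_expected_score a_def b_def)
  qed
  have lim0: "((\<lambda>p. p * a p) \<longlongrightarrow> 0) (at_right 0)"
    using lim_b[of 0] le
    by (intro tendsto_id_mult_zero_at_right[of a b]) (auto simp: a_def at_within_Icc_at_right)
  \<comment> \<open>The reflection \<open>x \<mapsto> 1 - x\<close> carries the endpoint 1 to 0 and
    exchanges the roles of \<open>a\<close> and \<open>b\<close>.\<close>
  have at_left_1: "at_left (1::real) = filtermap (\<lambda>x. 1 - x) (at_right 0)"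
    by (simp add: at_left_minus[of 1] at_right_to_0[of "-1"] filtermap_filtermap)
  have a_right: "((\<lambda>x. a (1 - x)) \<longlongrightarrow> a (1 - 0)) (at_right 0)"
  proof -
    have "(a \<longlongrightarrow> a 1) (at_left 1)"
      using lim_a[of 1] by (simp add: at_within_Icc_at_left)
    then show ?thesis
      by (simp add: at_left_1 filterlim_filtermap)
  qed
  have "((\<lambda>p. p * b (1 - p)) \<longlongrightarrow> 0) (at_right 0)"
  proof (rule tendsto_id_mult_zero_at_right[OF _ a_right])
    fix p q :: real assume "0 < p" "p < 1" "0 < q" "q < 1"
    then show "p * b (1 - p) + (1 - p) * a (1 - p) \<le> p * b (1 - q) + (1 - p) * a (1 - q)"
      using le[of "1 - p" "1 - q"] by simp
  qed (simp add: b_def)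
  then have lim1: "((\<lambda>p. (1 - p) * b p) \<longlongrightarrow> 0) (at_left 1)"
    by (simp add: at_left_1 filterlim_filtermap)
  have "continuous_on {0..1} (\<lambda>p. p * a p + (1 - p) * b p)"
    unfolding continuous_on_def
  proof
    fix p :: real assume "p \<in> {0..1}"
    then consider "p = 0" | "p = 1" | "0 < p" "p < 1" by fastforce
    then show "((\<lambda>p. p * a p + (1 - p) * b p) \<longlongrightarrow> p * a p + (1 - p) * b p) (at p within {0..1})"
    proof cases
      case 1
      have "((\<lambda>p. p * a p + (1 - p) * b p) \<longlongrightarrow> 0 + (1 - 0) * b 0) (at 0 within {0..1})"
        using lim0 by (intro tendsto_add tendsto_mult tendsto_diff tendsto_const tendsto_ident_at
            lim_b) (auto simp: at_within_Icc_at_right)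
      then show ?thesis using 1 by simp
    next
      case 2
      have "((\<lambda>p. p * a p + (1 - p) * b p) \<longlongrightarrow> 1 * a 1 + 0) (at 1 within {0..1})"
        using lim1 by (intro tendsto_add tendsto_mult tendsto_diff tendsto_const tendsto_ident_at
            lim_a) (auto simp: at_within_Icc_at_left)
      then show ?thesis using 2 by simp
    next
      case 3
      then show ?thesis by (intro tendsto_intros lim_a lim_b) auto
    qed
  qed
  then show ?thesis
    by (rule continuous_on_eq) (simp add: enn2real_expected_score_self a_def b_def)
qed

section \<open>Losses along segments and strictness of sums\<close>

lemma continuous_on_loss_segment:
  assumes "B \<noteq> {}" "\<And>E. E \<in> F \<Longrightarrow> p E \<in> {0..1}" "\<And>E. E \<in> F \<Longrightarrow> q E \<in> {0..1}"
  shows "continuous_on {0..1} (\<lambda>t::real. loss s F (\<lambda>E. (1 - t) * p E + t * q E) B)"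
  unfolding loss_def
proof (intro continuous_on_sum)
  fix E assume E: "E \<in> F"
  have "(1 - t) * p E + t * q E \<in> {0..1}" if "t \<in> {0..1}" for t
    using assms(2,3)[OF E] that by (intro segment_in_unit_interval) auto
  then have "(\<lambda>t. (1 - t) * p E + t * q E) ` {0..1} \<subseteq> {0..1}" by blast
  moreover have "continuous_on {0..1} (\<lambda>t. (1 - t) * p E + t * q E)"
    by (intro continuous_intros)
  ultimately show "continuous_on {0..1} (\<lambda>t. s (min_ind B E) ((1 - t) * p E + t * q E))"
    using continuous_on_compose2[OF continuous_on_score[OF min_ind_cases[OF assms(1)]]] by blast
qed

text \<open>The limit is taken in the extended half-line, so it also covers an infinite loss at
  \<open>p\<close>.\<close>

lemma loss_segment_tendsto:
  assumes "B \<noteq> {}" "\<And>E. E \<in> F \<Longrightarrow> p E \<in> {0..1}" "\<And>E. E \<in> F \<Longrightarrow> q E \<in> {0..1}"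
  shows "((\<lambda>t. loss s F (\<lambda>E. (1 - t) * p E + t * q E) B) \<longlongrightarrow> loss s F p B) (at_right 0)"
proof -
  have "((\<lambda>t. loss s F (\<lambda>E. (1 - t) * p E + t * q E) B) \<longlongrightarrow>
      loss s F (\<lambda>E. (1 - 0) * p E + 0 * q E) B) (at 0 within {0..1})"
    using continuous_on_loss_segment[of B F p q] assms unfolding continuous_on_def
    by (auto dest: bspec[of _ _ 0])
  then show ?thesis by (simp add: at_within_Icc_at_right)
qed

text \<open>Strictness at \<open>E0\<close> survives summation because the optimal scores of the
  other events have a finite sum.\<close>

lemma sum_expected_score_less:
  assumes F: "finite F" and pq: "\<And>E. E \<in> F \<Longrightarrow> p E \<in> {0..1}" "\<And>E. E \<in> F \<Longrightarrow> q E \<in> {0..1}"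
    and E0: "E0 \<in> F" "q E0 \<noteq> p E0"
  shows "(\<Sum>E\<in>F. expected_score s (p E) (p E)) < (\<Sum>E\<in>F. expected_score s (p E) (q E))"
proof -
  let ?R = "\<lambda>q. \<Sum>E\<in>F - {E0}. expected_score s (p E) (q E)"
  have "?R p < top"
    using F pq by (auto intro!: expected_score_self_finite)
  moreover have "expected_score s (p E0) (p E0) < expected_score s (p E0) (q E0)"
    using E0 pq by (intro expected_score_less) auto
  ultimately have "expected_score s (p E0) (p E0) + ?R p < expected_score s (p E0) (q E0) + ?R p"
    by (simp add: add.commute[of _ "?R p"] ennreal_add_left_cancel_less less_top)
  also have "\<dots> \<le> expected_score s (p E0) (q E0) + ?R q"
    using pq by (intro add_left_mono sum_mono expected_score_le) auto
  finally show ?thesis using F E0(1) by (simp add: sum.remove[of F E0])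
qed

section \<open>Solvability excludes domination\<close>

lemma system_solvable_imp_non_dominated:
  assumes F: "finite F" and V: "{} \<notin> V" and \<phi>: "assessment F \<phi>"
    and solv: "system_solvable F V \<phi>"
  shows "non_dominated s F V \<phi>"
  unfolding non_dominated_def
proof
  assume "\<exists>\<phi>'. assessment F \<phi>' \<and> (\<exists>E\<in>F. \<phi>' E \<noteq> \<phi> E) \<and> (\<forall>B\<in>V. loss s F \<phi>' B < loss s F \<phi> B)"
  then obtain \<phi>' E0 where \<phi>': "assessment F \<phi>'" and E0: "E0 \<in> F" "\<phi>' E0 \<noteq> \<phi> E0"
    and less: "\<And>B. B \<in> V \<Longrightarrow> loss s F \<phi>' B < loss s F \<phi> B" by blast
  obtain x where x: "prob_weights V x" and mix: "\<And>E. E \<in> F \<Longrightarrow> mixture V x E = \<phi> E"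
    using solv by (auto simp: system_solvable_iff_mixture)
  have in01: "\<phi> E \<in> {0..1}" "\<phi>' E \<in> {0..1}" if "E \<in> F" for E
    using \<phi> \<phi>' that by (auto simp: assessment_def)
  have "(\<Sum>E\<in>F. expected_score s (\<phi> E) (\<phi>' E)) = (\<Sum>B\<in>V. ennreal (x B) * loss s F \<phi>' B)"
    by (simp add: sum_loss_eq_expected_score[OF V x] mix)
  \<comment> \<open>A weak inequality suffices here; the contradiction comes from the strictness of
    propriety at \<open>E0\<close>.\<close>
  also have "\<dots> \<le> (\<Sum>B\<in>V. ennreal (x B) * loss s F \<phi> B)"
    using less by (intro sum_mono mult_left_mono) (auto intro: less_imp_le)
  also have "\<dots> = (\<Sum>E\<in>F. expected_score s (\<phi> E) (\<phi> E))"
    by (simp add: sum_loss_eq_expected_score[OF V x] mix)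
  also have "\<dots> < (\<Sum>E\<in>F. expected_score s (\<phi> E) (\<phi>' E))"
    using F in01 E0 by (intro sum_expected_score_less) auto
  finally show False by simp
qed

section \<open>Construction of a dominating assessment\<close>

lemma finite_losses_imp_dominated:
  assumes F: "finite F" and V: "finite V" "V \<noteq> {}" "{} \<notin> V" and \<phi>: "assessment F \<phi>"
    and fin: "\<And>B. B \<in> V \<Longrightarrow> loss s F \<phi> B < top"
    and not_solv: "\<not> system_solvable F V \<phi>"
  shows "\<exists>p. assessment F p \<and> (\<forall>B\<in>V. loss s F p B < loss s F \<phi> B)"
proof -
  define l where "l = (\<lambda>B. enn2real (loss s F \<phi> B))"
  \<comment> \<open>\<open>g\<close> is the entropy of the rule, and \<open>h x\<close> the Bregman
    divergence between \<open>\<phi>\<close> and the mixture with weights \<open>x\<close>. Its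
    positive minimum will be a common margin for all \<open>B\<close>.\<close>
  define g where "g = (\<lambda>p. enn2real (expected_score s p p))"
  define G where "G = (\<lambda>x. \<Sum>E\<in>F. g (mixture V x E))"
  define h where "h = (\<lambda>x. (\<Sum>B\<in>V. x B * l B) - G x)"
  define K where "K = {x :: 'a set \<Rightarrow> real. (\<forall>B. x B \<in> {0..1}) \<and> (\<Sum>B\<in>V. x B) = 1}"
  have l: "loss s F \<phi> B = ennreal (l B)" "0 \<le> l B" if "B \<in> V" for B
    using fin[OF that] by (auto simp: l_def)
  have K_weights: "prob_weights V x" if "x \<in> K" for x
    using that by (auto simp: K_def prob_weights_def)
  have mix01: "mixture V x E \<in> {0..1}" if "x \<in> K" for x E
    using mixture_bounds[OF V(3) K_weights[OF that]] .
  have g: "ennreal (g p) = expected_score s p p" "0 \<le> g p" if "p \<in> {0..1}" for p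
    using expected_score_self_finite[OF that] by (auto simp: g_def)
  have G: "ennreal (G x) = (\<Sum>E\<in>F. expected_score s (mixture V x E) (mixture V x E))" "0 \<le> G x"
    if "x \<in> K" for x
    unfolding G_def using mix01[OF that] g
    by (auto simp: sum_ennreal[symmetric] sum_nonneg)
  have avg: "ennreal (\<Sum>B\<in>V. x B * l B) = (\<Sum>E\<in>F. expected_score s (mixture V x E) (\<phi> E))"
    if "x \<in> K" for x
  proof -
    have "ennreal (\<Sum>B\<in>V. x B * l B) = (\<Sum>B\<in>V. ennreal (x B) * loss s F \<phi> B)"
      using that l by (simp add: K_def ennreal_mult sum_ennreal[symmetric])
    then show ?thesis using sum_loss_eq_expected_score[OF V(3) K_weights[OF that]] by metis
  qed
  \<comment> \<open>The divergence could vanish only if the mixture agreed with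
    \<open>\<phi>\<close> on \<open>F\<close>, which unsolvability excludes.\<close>
  have h_pos: "0 < h x" if x: "x \<in> K" for x
  proof -
    have "\<exists>E\<in>F. mixture V x E \<noteq> \<phi> E"
      using not_solv K_weights[OF x] by (auto simp: system_solvable_iff_mixture)
    then obtain E0 where E0: "E0 \<in> F" "\<phi> E0 \<noteq> mixture V x E0" by metis
    have in01: "\<phi> E \<in> {0..1}" if "E \<in> F" for E using \<phi> that by (auto simp: assessment_def)
    have "ennreal (G x) < ennreal (\<Sum>B\<in>V. x B * l B)"
      unfolding G(1)[OF x] avg[OF x]
      using F E0 in01 mix01[OF x] by (intro sum_expected_score_less) auto
    then show ?thesis using G(2)[OF x] by (simp add: h_def ennreal_less_iff)
  qed
  have coord: "continuous_on K (\<lambda>x. x B)" for B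
    using continuous_on_product_coordinates by (rule continuous_on_subset) simp
  have "continuous_on K h"
    unfolding h_def G_def g_def mixture_def
    using mix01 unfolding mixture_def
    by (intro continuous_intros coord
        continuous_on_compose2[OF continuous_on_expected_score_self]) auto
  moreover have "compact K" unfolding K_def by (rule compact_prob_weights[OF V(1)])
  moreover have "K \<noteq> {}"
  proof -
    obtain B where "B \<in> V" using V by blast
    then have "(\<lambda>B'. if B' = B then 1 else 0) \<in> K" using V(1) by (auto simp: K_def)
    then show ?thesis by blast
  qed
  ultimately obtain x where x: "x \<in> K" and min: "\<And>y. y \<in> K \<Longrightarrow> h x \<le> h y"
    using continuous_attains_inf[of K h] by blast
  \<comment> \<open>Optimality of \<open>x\<close> along the segment towards the vertex \<open>B\<close>; concavity of \<open>G\<close> replaces a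
    derivative.\<close>
  have bound: "ennreal (h x) + loss s F (mixture V x) B \<le> loss s F \<phi> B" if B: "B \<in> V" for B
  proof -
    define y where "y = (\<lambda>t B'. (1 - t) * x B' + t * (if B' = B then 1 else 0))"
    have sum_y: "(\<Sum>B'\<in>V. y t B' * c B') = (1 - t) * (\<Sum>B'\<in>V. x B' * c B') + t * c B" for t c
    proof -
      have "(\<Sum>B'\<in>V. y t B' * c B') =
          (\<Sum>B'\<in>V. (1 - t) * (x B' * c B') + (if B' = B then t * c B' else 0))"
        by (intro sum.cong refl) (simp add: y_def algebra_simps)
      then show ?thesis
        using V(1) B by (simp add: sum.distrib sum_distrib_left)
    qed
    have mix_y: "mixture V (y t) = (\<lambda>E. (1 - t) * mixture V x E + t * min_ind B E)" for t
      using sum_y[of t "\<lambda>B'. min_ind B' _"] by (simp add: mixture_def mult.commute fun_eq_iff)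
    have step: "ennreal (h x) + loss s F (mixture V (y t)) B \<le> loss s F \<phi> B"
      if t: "0 < t" "t < 1" for t
    proof -
      have yK: "y t \<in> K"
      proof -
        have "y t B' \<in> {0..1}" for B'
          unfolding y_def using x t by (intro segment_in_unit_interval) (auto simp: K_def)
        then show ?thesis using x sum_y[of t "\<lambda>_. 1"] by (simp add: K_def)
      qed
      define M where "M = enn2real (loss s F (mixture V (y t)) B)"
      \<comment> \<open>With the report \<open>mixture V (y t)\<close> held fixed, the expected
        score is affine in the weights.\<close>
      have eq: "ennreal (G (y t)) =
          ennreal (1 - t) * (\<Sum>E\<in>F. expected_score s (mixture V x E) (mixture V (y t) E)) +
          ennreal t * loss s F (mixture V (y t)) B"
      proof -
        have yt: "ennreal (y t B') * c = ennreal (1 - t) * (ennreal (x B') * c) +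
            (if B' = B then ennreal t * c else 0)" if "B' \<in> V" for B' c
          using t x that by (auto simp: y_def K_def ennreal_mult ennreal_plus distrib_right mult.assoc)
        have "ennreal (G (y t)) = (\<Sum>B'\<in>V. ennreal (y t B') * loss s F (mixture V (y t)) B')"
          using G(1)[OF yK] sum_loss_eq_expected_score[OF V(3) K_weights[OF yK]] by metis
        also have "\<dots> = ennreal (1 - t) *
            (\<Sum>B'\<in>V. ennreal (x B') * loss s F (mixture V (y t)) B') +
            ennreal t * loss s F (mixture V (y t)) B"
          using V(1) B by (simp add: yt sum.distrib sum_distrib_left)
        finally show ?thesis by (simp add: sum_loss_eq_expected_score[OF V(3) K_weights[OF x]])
      qed
      \<comment> \<open>The left side of \<open>eq\<close> is a real number and \<open>t\<close> is
        positive, so the loss at \<open>B\<close> is finite.\<close>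
      have "ennreal t * loss s F (mixture V (y t)) B < top"
        using eq by (metis ennreal_less_top ennreal_add_eq_top less_top)
      then have M: "loss s F (mixture V (y t)) B = ennreal M" "0 \<le> M"
        using t by (auto simp: M_def ennreal_mult_less_top)
      \<comment> \<open>Under the weights \<open>x\<close>, the best report is
        \<open>mixture V x\<close>, with expected score \<open>G x\<close>.\<close>
      have "ennreal (1 - t) * ennreal (G x) + ennreal t * ennreal M \<le> ennreal (G (y t))"
        unfolding eq M(1) G(1)[OF x] using mix01[OF x] mix01[OF yK]
        by (intro add_right_mono mult_left_mono sum_mono expected_score_le) auto
      then have "ennreal ((1 - t) * G x + t * M) \<le> ennreal (G (y t))"
        using t M(2) G(2)[OF x] by (simp add: ennreal_mult ennreal_plus)
      then have "(1 - t) * G x + t * M \<le> G (y t)"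
        using G(2)[OF yK] by (simp add: ennreal_le_iff)
      moreover have "h x \<le> (1 - t) * (\<Sum>B\<in>V. x B * l B) + t * l B - G (y t)"
        using min[OF yK] sum_y[of t l] by (simp add: h_def)
      \<comment> \<open>Together these give \<open>h x \<le> (1 - t) * h x + t * (l B - M)\<close>;
        what remains after cancelling carries a factor \<open>t\<close>.\<close>
      ultimately have "t * (h x + M) \<le> t * l B"
        by (simp add: h_def algebra_simps)
      then have "h x + M \<le> l B" using t by simp
      then show ?thesis
        using h_pos[OF x] M l[OF B] by (simp flip: ennreal_plus)
    qed
    \<comment> \<open>As \<open>t\<close> tends to 0 the report returns to
      \<open>mixture V x\<close>. Its loss is not yet known to be finite, hence the extended-valued
      limit. The limit keeps only a weak inequality, but the constant \<open>h x\<close> preserves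
      the gap.\<close>
    have "((\<lambda>t. ennreal (h x) + loss s F (mixture V (y t)) B) \<longlongrightarrow>
        ennreal (h x) + loss s F (mixture V x) B) (at_right 0)"
      unfolding mix_y using V(3) B mix01[OF x] min_ind_bounds[of B]
      by (intro tendsto_add tendsto_const loss_segment_tendsto) auto
    moreover have "eventually (\<lambda>t. ennreal (h x) + loss s F (mixture V (y t)) B \<le> loss s F \<phi> B)
        (at_right 0)"
      using eventually_at_right_real[of 0 1] by (auto elim: eventually_mono intro: step)
    ultimately show ?thesis by (intro tendsto_upperbound) auto
  qed
  have "loss s F (mixture V x) B < loss s F \<phi> B" if B: "B \<in> V" for B
  proof -
    \<comment> \<open>Finiteness is needed because adding \<open>h x\<close> to an infinite loss
      would not increase it.\<close>
    have "loss s F (mixture V x) B < top"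
      using bound[OF B] fin[OF B] by (metis ennreal_add_eq_top less_top neq_top_trans)
    then have "loss s F (mixture V x) B < ennreal (h x) + loss s F (mixture V x) B"
      using h_pos[OF x] by (cases "loss s F (mixture V x) B") (auto simp flip: ennreal_plus
          simp: ennreal_less_iff)
    then show ?thesis using bound[OF B] by order
  qed
  moreover have "assessment F (mixture V x)" using mix01[OF x] by (auto simp: assessment_def)
  ultimately show ?thesis by blast
qed

lemma not_system_solvable_imp_dominated:
  assumes F: "finite F" and V: "finite V" "V \<noteq> {}" "{} \<notin> V" and \<phi>: "assessment F \<phi>"
    and not_solv: "\<not> system_solvable F V \<phi>"
  shows "\<exists>\<phi>'. assessment F \<phi>' \<and> (\<forall>B\<in>V. loss s F \<phi>' B < loss s F \<phi> B)"
proof -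
  define W where "W = {B \<in> V. loss s F \<phi> B < top}"
  have W: "finite W" "{} \<notin> W" "W \<subseteq> V" using V by (auto simp: W_def)
  \<comment> \<open>Weights on \<open>W\<close>, extended by 0, would solve the system over
    \<open>V\<close>.\<close>
  have not_solv_W: "\<not> system_solvable F W \<phi>"
  proof
    assume "system_solvable F W \<phi>"
    then obtain x where x: "prob_weights W x" "\<forall>E\<in>F. mixture W x E = \<phi> E"
      by (auto simp: system_solvable_iff_mixture)
    define x' where "x' = (\<lambda>B. if B \<in> W then x B else 0)"
    have sums: "(\<Sum>B\<in>V. c B * x' B) = (\<Sum>B\<in>W. c B * x B)" for c
      using V(1) W(3) by (intro sum.mono_neutral_cong_right) (auto simp: x'_def)
    have "prob_weights V x'"
      using sums[of "\<lambda>_. 1"] x(1) by (auto simp: prob_weights_def x'_def)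
    moreover have "\<forall>E\<in>F. mixture V x' E = \<phi> E"
      using x(2) sums by (simp add: mixture_def)
    ultimately show False using not_solv by (auto simp: system_solvable_iff_mixture)
  qed
  \<comment> \<open>If \<open>W\<close> is empty there is nothing to improve yet, and
    \<open>\<phi>\<close> itself serves as \<open>p\<close>.\<close>
  obtain p where p: "assessment F p" "\<And>B. B \<in> W \<Longrightarrow> loss s F p B < loss s F \<phi> B"
  proof (cases "W = {}")
    case True
    then show ?thesis using that \<phi> by blast
  next
    case False
    then show ?thesis
      using finite_losses_imp_dominated[OF F W(1) False W(2) \<phi> _ not_solv_W] that
      by (auto simp: W_def)
  qed
  \<comment> \<open>Any interior target would do for \<open>1 / 2\<close>: once
    \<open>0 < t < 1\<close>, all values are interior and all scores finite.\<close>
  define q where "q = (\<lambda>t E. (1 - t) * p E + t * (1 / 2 :: real))"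
  have "eventually (\<lambda>t. loss s F (q t) B < loss s F \<phi> B) (at_right 0)" if "B \<in> W" for B
    unfolding q_def
    by (intro order_tendstoD(2)[OF loss_segment_tendsto] p(2) that)
      (use W(2) that p(1) in \<open>auto simp: assessment_def\<close>)
  then have "eventually (\<lambda>t. \<forall>B\<in>W. loss s F (q t) B < loss s F \<phi> B) (at_right 0)"
    using W(1) by (simp add: eventually_ball_finite)
  moreover have "eventually (\<lambda>t. 0 < t \<and> t < 1) (at_right (0::real))"
    using eventually_at_right_real[of 0 1] by (auto elim: eventually_mono)
  ultimately have "eventually (\<lambda>t. (\<forall>B\<in>W. loss s F (q t) B < loss s F \<phi> B) \<and> 0 < t \<and> t < 1)
      (at_right 0)"
    by eventually_elim simp
  then obtain t where t: "\<And>B. B \<in> W \<Longrightarrow> loss s F (q t) B < loss s F \<phi> B" "0 < t" "t < 1"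
    using eventually_happens trivial_limit_at_right_real by blast
  have q01: "0 < q t E \<and> q t E < 1" if "E \<in> F" for E
  proof -
    have "0 \<le> (1 - t) * p E" "(1 - t) * p E \<le> 1 - t"
      using p(1) that t by (auto simp: assessment_def Pi_iff intro!: mult_left_le)
    then show ?thesis using t unfolding q_def by linarith
  qed
  have "loss s F (q t) B < loss s F \<phi> B" if B: "B \<in> V" for B
  proof (cases "B \<in> W")
    case False
    \<comment> \<open>Outside \<open>W\<close> the loss of \<open>\<phi>\<close> is infinite, so a
      finite loss is already smaller.\<close>
    have "loss s F (q t) B < top"
      unfolding loss_def using F q01 min_ind_cases[of B] V(3) B
      by (auto intro!: score_interior_finite)
    then show ?thesis using False B by (simp add: W_def less_top[symmetric])
  qed (rule t)
  moreover have "assessment F (q t)" using q01 by (force simp: assessment_def)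
  ultimately show ?thesis by blast
qed

text \<open>Leaving \<open>V\<close> arbitrary makes non-empty events, atoms and chains instances of
  one equivalence.\<close>

proposition system_solvable_iff_non_dominated:
  assumes F: "finite F" "F \<noteq> {}" and V: "finite V" "{} \<notin> V" and \<phi>: "assessment F \<phi>"
  shows "system_solvable F V \<phi> \<longleftrightarrow> non_dominated s F V \<phi>"
proof (cases "V = {}")
  case True
  obtain E where E: "E \<in> F" using F by blast
  \<comment> \<open>Over an empty \<open>V\<close> weights cannot sum to 1, and any different
    assessment dominates vacuously; this one differs from \<open>\<phi>\<close> at every
    event.\<close>
  have "assessment F (\<lambda>E. if \<phi> E = 0 then 1 else 0)" by (auto simp: assessment_def)
  moreover have "(\<lambda>E. if \<phi> E = 0 then 1 else 0) E \<noteq> \<phi> E" by simp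
  ultimately have "\<not> non_dominated s F V \<phi>"
    using True E unfolding non_dominated_def by blast
  then show ?thesis using True by (simp add: system_solvable_def)
next
  case False
  show ?thesis
  proof
    assume "system_solvable F V \<phi>"
    then show "non_dominated s F V \<phi>"
      by (rule system_solvable_imp_non_dominated[OF F(1) V(2) \<phi>])
  next
    assume nd: "non_dominated s F V \<phi>"
    show "system_solvable F V \<phi>"
    proof (rule ccontr)
      assume "\<not> system_solvable F V \<phi>"
      then obtain \<phi>' where \<phi>': "assessment F \<phi>'" "\<forall>B\<in>V. loss s F \<phi>' B < loss s F \<phi> B"
        using not_system_solvable_imp_dominated[OF F(1) V(1) False V(2) \<phi>] by blast
      have "\<exists>E\<in>F. \<phi>' E \<noteq> \<phi> E"
      proof (rule ccontr)
        assume "\<not> ?thesis"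
        then have "loss s F \<phi>' B = loss s F \<phi> B" for B by (simp add: loss_def)
        then show False using \<phi>'(2) False by auto
      qed
      then show False using nd \<phi>' unfolding non_dominated_def by blast
    qed
  qed
qed

end

section \<open>Finiteness of the generated algebra and of chains\<close>

lemma finite_gen_algebra:
  assumes "finite \<F>" "\<F> \<subseteq> Pow \<Omega>"
  shows "finite (gen_algebra \<Omega> \<F>)"
proof -
  \<comment> \<open>Classify points by the members of \<open>\<F>\<close> containing them;
    \<open>f S\<close> collects those whose pattern lies in \<open>S\<close>. Since \<open>f\<close>
    respects complements and unions, its values form a finite algebra.\<close>
  define f where "f = (\<lambda>S. {\<omega>\<in>\<Omega>. {E\<in>\<F>. \<omega> \<in> E} \<in> S})"
  have "algebra \<Omega> (f ` Pow (Pow \<F>))"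
    unfolding algebra_iff_Un
  proof (intro conjI ballI)
    show "f ` Pow (Pow \<F>) \<subseteq> Pow \<Omega>" by (auto simp: f_def)
    show "{} \<in> f ` Pow (Pow \<F>)" by (rule image_eqI[of _ _ "{}"]) (auto simp: f_def)
    fix a assume "a \<in> f ` Pow (Pow \<F>)"
    then obtain S where S: "a = f S" "S \<subseteq> Pow \<F>" by auto
    have "\<Omega> - a = f (Pow \<F> - S)" using S by (auto simp: f_def)
    then show "\<Omega> - a \<in> f ` Pow (Pow \<F>)" by auto
    fix b assume "b \<in> f ` Pow (Pow \<F>)"
    then obtain T where T: "b = f T" "T \<subseteq> Pow \<F>" by auto
    have "a \<union> b = f (S \<union> T)" using S T by (auto simp: f_def)
    then show "a \<union> b \<in> f ` Pow (Pow \<F>)" using S T by auto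
  qed
  moreover have "\<F> \<subseteq> f ` Pow (Pow \<F>)"
  proof
    fix E assume "E \<in> \<F>"
    then have "E = f {S \<in> Pow \<F>. E \<in> S}" using assms by (auto simp: f_def)
    then show "E \<in> f ` Pow (Pow \<F>)" by auto
  qed
  ultimately have "gen_algebra \<Omega> \<F> \<subseteq> f ` Pow (Pow \<F>)"
    unfolding gen_algebra_def by blast
  then show ?thesis using assms(1) by (auto intro: finite_subset)
qed

text \<open>Prefixes have length at least 1, so every union contains the non-empty atom
  \<open>cs ! 0\<close>.\<close>

lemma chains_finite_nonempty:
  assumes "\<D> \<in> chains \<Omega> \<F>"
  shows "finite \<D>" "{} \<notin> \<D>"
proof -
  obtain cs where cs: "set cs = atoms \<Omega> \<F>"
    and D: "\<D> = (\<lambda>k. \<Union>(set (take k cs))) ` {1..length cs}"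
    using assms unfolding chains_def by (simp only: mem_Collect_eq Setcompr_eq_image) blast
  show "finite \<D>" unfolding D by simp
  show "{} \<notin> \<D>"
  proof
    assume "{} \<in> \<D>"
    then obtain k where k: "1 \<le> k" "k \<le> length cs" "\<Union>(set (take k cs)) = {}"
      unfolding D by auto
    then have "cs ! 0 \<in> set (take k cs)"
      by (metis less_le_trans less_numeral_extra(1) in_set_conv_nth length_take min.absorb2 nth_take)
    moreover have "cs ! 0 \<noteq> {}"
    proof -
      have "cs ! 0 \<in> atoms \<Omega> \<F>" using k(1,2) cs by (metis less_le_trans zero_less_one nth_mem)
      then show ?thesis by (simp add: atoms_def nonempty_events_def)
    qed
    ultimately show False using k(3) by blast
  qed
qed

section \<open>From finite families to the three coherence notions\<close>

theorem theorem2: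
  fixes \<Omega> :: "'a set" and \<E> :: "'a set set" and s :: "real \<Rightarrow> real \<Rightarrow> ennreal"
  assumes "\<Omega> \<noteq> {}" and "\<E> \<subseteq> Pow \<Omega>" and "\<E> \<noteq> {}" and "proper_scoring_rule s"
  shows "(\<forall>Bel. assessment \<E> Bel \<longrightarrow> (coherent_3 \<Omega> \<E> Bel \<longleftrightarrow> coherent_5 s \<Omega> \<E> Bel)) \<and>
         (\<forall>P. assessment \<E> P \<longrightarrow> (coherent_3P \<Omega> \<E> P \<longleftrightarrow> coherent_5P s \<Omega> \<E> P)) \<and>
         (\<forall>N. assessment \<E> N \<longrightarrow> (coherent_3N \<Omega> \<E> N \<longleftrightarrow> coherent_5N s \<Omega> \<E> N))"
proof -
  have key: "system_solvable \<F> \<V> \<phi> \<longleftrightarrow> non_dominated s \<F> \<V> \<phi>"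
    if "assessment \<E> \<phi>" "finite \<F> \<and> \<F> \<noteq> {} \<and> \<F> \<subseteq> \<E>" "finite \<V>" "{} \<notin> \<V>" for \<phi> \<F> \<V>
    using that assms(4)
    by (intro system_solvable_iff_non_dominated) (auto simp: assessment_def)
  have fin: "finite (nonempty_events \<Omega> \<F>)" "finite (atoms \<Omega> \<F>)"
    if "finite \<F> \<and> \<F> \<noteq> {} \<and> \<F> \<subseteq> \<E>" for \<F>
    using finite_gen_algebra[of \<F> \<Omega>] that assms(2) by (auto simp: nonempty_events_def atoms_def)
  have ne: "{} \<notin> nonempty_events \<Omega> \<F>" "{} \<notin> atoms \<Omega> \<F>" for \<F>
    by (auto simp: nonempty_events_def atoms_def)
  have 3: "coherent_3 \<Omega> \<E> \<phi> \<longleftrightarrow> coherent_5 s \<Omega> \<E> \<phi>" if "assessment \<E> \<phi>" for \<phi>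
    unfolding coherent_3_def coherent_5_def using key[OF that _ fin(1) ne(1)] by blast
  have P: "coherent_3P \<Omega> \<E> \<phi> \<longleftrightarrow> coherent_5P s \<Omega> \<E> \<phi>" if "assessment \<E> \<phi>" for \<phi>
    unfolding coherent_3P_def coherent_5P_def using key[OF that _ fin(2) ne(2)] by blast
  have N: "coherent_3N \<Omega> \<E> \<phi> \<longleftrightarrow> coherent_5N s \<Omega> \<E> \<phi>" if \<phi>: "assessment \<E> \<phi>" for \<phi>
  proof -
    \<comment> \<open>The equivalence holds chain by chain, so the same chain is a witness on both
      sides.\<close>
    have "(\<exists>\<D>\<in>chains \<Omega> \<F>. system_solvable \<F> \<D> \<phi>) \<longleftrightarrow>
        (\<exists>\<D>\<in>chains \<Omega> \<F>. non_dominated s \<F> \<D> \<phi>)"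
      if "finite \<F> \<and> \<F> \<noteq> {} \<and> \<F> \<subseteq> \<E>" for \<F>
      using key[OF \<phi> that] chains_finite_nonempty[of _ \<Omega> \<F>] by (intro bex_cong refl) simp
    then show ?thesis unfolding coherent_3N_def coherent_5N_def by simp
  qed
  show ?thesis using 3 P N by blast
qed

end
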